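(* Let $L$ be the Laplacian matrix of a weight-balanced weighted digraph with vertex set $\{1,\ldots,n\}$. Assume that the eigenvalue $0$ of $L$ has geometric multiplicity one. Then every $L$-invariant anti-synchrony subspace of $\mathbb{R}^n$ is evenly tagged.
   Context: A digraph is a pair $(V_G,E_G)$ with $V_G$ a finite vertex set and $E_G\subseteq V_G\times V_G$ a set of arrows (loops are allowed, multiple arrows are not). A weighted digraph $(G,w)$ is a digraph $G$ with a weight function $w:E_G\to\mathbb{R}\setminus\{0\}$. For vertex set $\{1,\ldots,n\}$, the adjacency matrix $A$ is given by $A_{i,j}=w(j,i)$ if $(j,i)\in E_G$ and $A_{i,j}=0$ otherwise. The Laplacian matrix is $L_{i,j}=\left(\sum_{k=1}^nA_{i,k}\right)\delta_{i,j}-A_{i,j}$. The weighted digraph is weight-balanced if for every vertex $i$ the out-degree $d^+(i)=\sum_{j}A_{j,i}$ equals the in-degree $d^-(i)=\sum_jA_{i,j}$, i.e. the $i$-th row sum of $A$ equals the $i$-th column sum of $A$ for all $i$. A subspace $V\subseteq\mathbb{R}^n$ is $L$-invariant if $LV\subseteq V$. A partial involution on a set $X$ is a map $x\mapsto x^*:\tilde X\to\tilde X$ defined on a (possibly empty) subset $\tilde X\subseteq X$ that is its own inverse. A tagged partition of a finite set $C$ is a partition $\mathcal{P}$ of $C$ (into nonempty classes) together with a partial involution $P\mapsto P^*$ on $\mathcal{P}$ that has at most one fixed point. The class of $i$ is denoted by $[i]$. For a tagged partition $\mathcal{P}$ of $\{1,\ldots,n\}$, the polydiagonal subspace is $$\Delta_{\mathcal{P}}=\{x\in\mathbb{R}^n\mid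 x_i=x_j\text{ if }[i]=[j],\text{ and }x_i=-x_j\text{ if }[i]^*=[j]\}.$$ Distinct tagged partitions give distinct polydiagonal subspaces. $\Delta_{\mathcal{P}}$ is an anti-synchrony subspace if the partial involution is not the empty function. $\Delta_{\mathcal{P}}$ is fully tagged if the partial involution is defined on all of $\mathcal{P}$, and evenly tagged if it is fully tagged and $\#P=\#P^*$ for all $P\in\mathcal{P}$. *)

theory Defs
  imports
    "HOL-Analysis.Analysis"
    "HOL-Library.Disjoint_Sets"
    "Graph_Theory.Pair_Digraph"
    "Graph_Theory.Weighted_Graph"
begin

text \<open>The vertices \<open>1, \<dots>, n\<close> are the elements of a finite type \<open>'n\<close>, so that \<open>real ^ 'n\<close> is the
  space on which the Laplacian acts.  The library predicate \<open>pair_fin_digraph\<close> allows loops and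
  excludes multiple arcs.  The weight function is total, but its values outside \<open>parcs G\<close> are
  never used.\<close>

definition weighted_digraph :: "'n::finite pair_pre_digraph \<Rightarrow> ('n \<times> 'n) weight_fun \<Rightarrow> bool" where
  "weighted_digraph G w \<longleftrightarrow>
     pair_fin_digraph G \<and> pverts G = UNIV \<and> (\<forall>e\<in>parcs G. w e \<noteq> 0)"

text \<open>Row index is the head of the arc, column index its tail.\<close>

definition adjacency_matrix ::
    "'n::finite pair_pre_digraph \<Rightarrow> ('n \<times> 'n) weight_fun \<Rightarrow> real ^ 'n ^ 'n" where
  "adjacency_matrix G w = (\<chi> i j. if (j, i) \<in> parcs G then w (j, i) else 0)"

definition laplacian_matrix ::
    "'n::finite pair_pre_digraph \<Rightarrow> ('n \<times> 'n) weight_fun \<Rightarrow> real ^ 'n ^ 'n" where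
  "laplacian_matrix G w =
     (\<chi> i j. (if i = j then \<Sum>k\<in>UNIV. adjacency_matrix G w $ i $ k else 0)
             - adjacency_matrix G w $ i $ j)"

definition weighted_out_degree ::
    "'n::finite pair_pre_digraph \<Rightarrow> ('n \<times> 'n) weight_fun \<Rightarrow> 'n \<Rightarrow> real" where
  "weighted_out_degree G w i = (\<Sum>j\<in>UNIV. adjacency_matrix G w $ j $ i)"

definition weighted_in_degree ::
    "'n::finite pair_pre_digraph \<Rightarrow> ('n \<times> 'n) weight_fun \<Rightarrow> 'n \<Rightarrow> real" where
  "weighted_in_degree G w i = (\<Sum>j\<in>UNIV. adjacency_matrix G w $ i $ j)"

definition weight_balanced :: "'n::finite pair_pre_digraph \<Rightarrow> ('n \<times> 'n) weight_fun \<Rightarrow> bool" where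
  "weight_balanced G w \<longleftrightarrow> (\<forall>i. weighted_out_degree G w i = weighted_in_degree G w i)"

definition geometric_multiplicity :: "real ^ 'n ^ 'n \<Rightarrow> real \<Rightarrow> nat" where
  "geometric_multiplicity A c = dim {x :: real ^ 'n. A *v x = c *\<^sub>R x}"

definition invariant_under :: "real ^ 'n ^ 'n \<Rightarrow> (real ^ 'n) set \<Rightarrow> bool" where
  "invariant_under A V \<longleftrightarrow> (*v) A ` V \<subseteq> V"

text \<open>The domain of the partial map is the subset on which the partial involution is defined.  The
  second conjunct makes the map take values in its own domain and be its own inverse there.\<close>

definition partial_involution :: "'a set \<Rightarrow> ('a \<rightharpoonup> 'a) \<Rightarrow> bool" where
  "partial_involution X f \<longleftrightarrow> dom f \<subseteq> X \<and> (\<forall>x y. f x = Some y \<longrightarrow> f y = Some x)"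

definition tagged_partition :: "'a set \<Rightarrow> 'a set set \<Rightarrow> ('a set \<rightharpoonup> 'a set) \<Rightarrow> bool" where
  "tagged_partition C P f \<longleftrightarrow>
     finite C \<and> partition_on C P \<and> partial_involution P f \<and>
     (\<forall>A B. f A = Some A \<and> f B = Some B \<longrightarrow> A = B)"

definition class_of :: "'a set set \<Rightarrow> 'a \<Rightarrow> 'a set" where
  "class_of P i = (THE A. A \<in> P \<and> i \<in> A)"

definition polydiagonal :: "'n set set \<Rightarrow> ('n set \<rightharpoonup> 'n set) \<Rightarrow> (real ^ 'n) set" where
  "polydiagonal P f =
     {x. \<forall>i j. (class_of P i = class_of P j \<longrightarrow> x $ i = x $ j) \<and>
               (f (class_of P i) = Some (class_of P j) \<longrightarrow> x $ i = - x $ j)}"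

text \<open>Distinct tagged partitions have distinct polydiagonal subspaces, so the kinds of polydiagonal
  subspaces are expressed as properties of the tagged partition \<open>(P, f)\<close>.\<close>

definition anti_synchrony :: "('n set \<rightharpoonup> 'n set) \<Rightarrow> bool" where
  "anti_synchrony f \<longleftrightarrow> f \<noteq> Map.empty"

definition fully_tagged :: "'n set set \<Rightarrow> ('n set \<rightharpoonup> 'n set) \<Rightarrow> bool" where
  "fully_tagged P f \<longleftrightarrow> dom f = P"

definition evenly_tagged :: "'n set set \<Rightarrow> ('n set \<rightharpoonup> 'n set) \<Rightarrow> bool" where
  "evenly_tagged P f \<longleftrightarrow> fully_tagged P f \<and> (\<forall>A\<in>P. card A = card (the (f A)))"

end

(* Weight balance makes every column of the Laplacian L sum to zero, so the range of L consists of
   vectors with coordinate sum zero. An anti-synchrony subspace V meets the kernel of L, the line of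
   constant vectors, only in zero, so an invariant V satisfies L V = V and lies in the range of L.
   Indicator vectors of untagged classes, and differences of indicator vectors of paired classes,
   lie in V; that their coordinate sums vanish is the claim. *)

theory Submission
  imports Defs
begin

lemma class_of_eq:
  assumes "partition_on UNIV P" "A \<in> P" "i \<in> A"
  shows "class_of P i = A"
  unfolding class_of_def
proof (rule the_equality)
  show "B = A" if "B \<in> P \<and> i \<in> B" for B
    using that assms partition_onD2[OF assms(1)] by (auto simp: disjoint_def)
qed (use assms in blast)

text \<open>Turns the conditions on classes in \<open>polydiagonal\<close> into membership
  conditions, on which indicator vectors can be evaluated.\<close>

lemma class_of_eq_iff:
  assumes "partition_on UNIV P" "A \<in> P"
  shows "class_of P i = A \<longleftrightarrow> i \<in> A"
proof
  assume eq: "class_of P i = A"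
  obtain B where "B \<in> P" "i \<in> B"
    using partition_onD1[OF assms(1)] by blast
  then show "i \<in> A"
    using class_of_eq[OF assms(1)] eq by metis
qed (use class_of_eq[OF assms] in blast)

lemma tagged_partitionD:
  assumes "tagged_partition C P f"
  shows "partition_on C P" "dom f \<subseteq> P" "f A = Some B \<Longrightarrow> f B = Some A"
  using assms unfolding tagged_partition_def partial_involution_def by blast+

text \<open>The diagonal term is the full row sum of the adjacency matrix, so each row of the
  Laplacian cancels.\<close>

lemma laplacian_matrix_mult_one: "laplacian_matrix G w *v 1 = 0"
  by (simp add: vec_eq_iff matrix_vector_mult_def laplacian_matrix_def sum_subtractf)

lemma sum_laplacian_matrix_mult:
  fixes G :: "'n::finite pair_pre_digraph"
  assumes "weight_balanced G w"
  shows "(\<Sum>i\<in>UNIV. (laplacian_matrix G w *v x) $ i) = 0"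
proof -
  \<comment> \<open>The diagonal term contributes the in-degree of \<open>j\<close>, and the
    subtracted adjacency column adds up to its out-degree.\<close>
  have column: "(\<Sum>i\<in>UNIV. laplacian_matrix G w $ i $ j) = 0" for j
    using assms
    by (simp add: laplacian_matrix_def sum_subtractf weight_balanced_def
        weighted_out_degree_def weighted_in_degree_def)
  have "(\<Sum>i\<in>UNIV. (laplacian_matrix G w *v x) $ i)
      = (\<Sum>j\<in>UNIV. \<Sum>i\<in>UNIV. laplacian_matrix G w $ i $ j * x $ j)"
    by (subst sum.swap) (simp add: matrix_vector_mult_def)
  also have "\<dots> = 0"
    by (simp add: sum_distrib_right[symmetric] column)
  finally show ?thesis .
qed

lemma subspace_polydiagonal: "subspace (polydiagonal P f)"
proof (rule subspaceI)
  show "0 \<in> polydiagonal P f"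
    unfolding polydiagonal_def mem_Collect_eq zero_index minus_zero by (intro allI conjI impI refl)
next
  fix x y
  assume mem: "x \<in> polydiagonal P f" "y \<in> polydiagonal P f"
  show "x + y \<in> polydiagonal P f"
    unfolding polydiagonal_def mem_Collect_eq
  proof (intro allI conjI impI)
    fix i j
    assume "class_of P i = class_of P j"
    then have "x $ i = x $ j" "y $ i = y $ j"
      using mem unfolding polydiagonal_def mem_Collect_eq by iprover+
    then show "(x + y) $ i = (x + y) $ j"
      by simp
  next
    fix i j
    assume "f (class_of P i) = Some (class_of P j)"
    then have "x $ i = - x $ j" "y $ i = - y $ j"
      using mem unfolding polydiagonal_def mem_Collect_eq by iprover+
    then show "(x + y) $ i = - (x + y) $ j"
      unfolding vector_add_component by linarith
  qed
next
  fix c x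
  assume mem: "x \<in> polydiagonal P f"
  show "c *\<^sub>R x \<in> polydiagonal P f"
    unfolding polydiagonal_def mem_Collect_eq
  proof (intro allI conjI impI)
    fix i j
    assume "class_of P i = class_of P j"
    then have "x $ i = x $ j"
      using mem unfolding polydiagonal_def mem_Collect_eq by iprover
    then show "(c *\<^sub>R x) $ i = (c *\<^sub>R x) $ j"
      by simp
  next
    fix i j
    assume "f (class_of P i) = Some (class_of P j)"
    then have "x $ i = - x $ j"
      using mem unfolding polydiagonal_def mem_Collect_eq by iprover
    then show "(c *\<^sub>R x) $ i = - (c *\<^sub>R x) $ j"
      unfolding vector_scaleR_component scaleR_minus_right[symmetric] by (rule arg_cong)
  qed
qed

text \<open>Some class \<open>A\<close> is paired with a class \<open>B\<close>, possibly itself,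
  and both are nonempty. Comparing a coordinate in \<open>A\<close> with one in \<open>B\<close>
  gives \<open>c = - c\<close>.\<close>

lemma constant_in_polydiagonal_eq_0:
  fixes P :: "'n::finite set set"
  assumes "tagged_partition UNIV P f" "anti_synchrony f" "c *\<^sub>R 1 \<in> polydiagonal P f"
  shows "c = 0"
proof -
  note part_P = tagged_partitionD(1)[OF assms(1)]
  obtain A B where AB: "f A = Some B"
    using assms(2) unfolding anti_synchrony_def by (metis ext not_None_eq)
  then have "A \<in> P" "B \<in> P"
    using tagged_partitionD(2,3)[OF assms(1)] by (metis domI subsetD)+
  obtain i j where "i \<in> A" "j \<in> B"
    using \<open>A \<in> P\<close> \<open>B \<in> P\<close> partition_onD3[OF part_P] by (metis ex_in_conv)
  have "f (class_of P i) = Some (class_of P j)"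
    unfolding class_of_eq[OF part_P \<open>A \<in> P\<close> \<open>i \<in> A\<close>] class_of_eq[OF part_P \<open>B \<in> P\<close> \<open>j \<in> B\<close>]
    by (rule AB)
  then have "(c *\<^sub>R 1 :: real ^ 'n) $ i = - (c *\<^sub>R 1 :: real ^ 'n) $ j"
    using assms(3) unfolding polydiagonal_def by blast
  then show ?thesis by simp
qed

lemma indicator_in_polydiagonal:
  fixes P :: "'n::finite set set"
  assumes "tagged_partition UNIV P f" "A \<in> P" "f A = None"
  shows "(\<chi> i. indicator A i) \<in> polydiagonal P f"
proof -
  note part_P = tagged_partitionD(1)[OF assms(1)] and inv = tagged_partitionD(3)[OF assms(1)]
  note mem = class_of_eq_iff[OF part_P assms(2), symmetric]
  show ?thesis
    unfolding polydiagonal_def mem_Collect_eq vec_lambda_beta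
  proof (intro allI conjI impI)
    fix i j
    assume "class_of P i = class_of P j"
    then have "i \<in> A \<longleftrightarrow> j \<in> A"
      unfolding mem by simp
    then show "indicator A i = (indicator A j :: real)"
      by (simp add: indicator_def)
  next
    fix i j
    assume "f (class_of P i) = Some (class_of P j)"
    \<comment> \<open>The involution maps its domain to itself, so both classes lie in
      \<open>dom f\<close> and neither is the untagged class \<open>A\<close>. Hence the sign
      condition only compares zeros.\<close>
    then have "i \<notin> A \<and> j \<notin> A"
      unfolding mem using inv assms(3) by (metis option.distinct(1))
    then show "indicator A i = - (indicator A j :: real)"
      by simp
  qed
qed

text \<open>Swapping \<open>A\<close> and \<open>B\<close> negates the vector, as the sign condition
  demands. If \<open>A = B\<close>, the vector is zero.\<close>

lemma indicator_diff_in_polydiagonal: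
  fixes P :: "'n::finite set set"
  assumes "tagged_partition UNIV P f" "f A = Some B"
  shows "(\<chi> i. indicator A i - indicator B i) \<in> polydiagonal P f"
proof -
  note part_P = tagged_partitionD(1)[OF assms(1)] and inv = tagged_partitionD(3)[OF assms(1)]
  have "A \<in> P" "B \<in> P"
    using tagged_partitionD(2)[OF assms(1)] assms(2) inv[OF assms(2)] by (metis domI subsetD)+
  note mem = class_of_eq_iff[OF part_P \<open>A \<in> P\<close>, symmetric]
    class_of_eq_iff[OF part_P \<open>B \<in> P\<close>, symmetric]
  have fB: "f B = Some A"
    using inv[OF assms(2)] .
  show ?thesis
    unfolding polydiagonal_def mem_Collect_eq vec_lambda_beta
  proof (intro allI conjI impI)
    fix i j
    assume "class_of P i = class_of P j"
    then have "i \<in> A \<longleftrightarrow> j \<in> A" "i \<in> B \<longleftrightarrow> j \<in> B"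
      unfolding mem by simp_all
    then show "indicator A i - indicator B i = (indicator A j - indicator B j :: real)"
      by (simp add: indicator_def)
  next
    fix i j
    assume "f (class_of P i) = Some (class_of P j)"
    \<comment> \<open>Being its own inverse, \<open>f\<close> is injective on its domain, so
      \<open>B\<close> is the only partner of \<open>A\<close> and conversely.\<close>
    then have "i \<in> A \<longleftrightarrow> j \<in> B" "i \<in> B \<longleftrightarrow> j \<in> A"
      unfolding mem using inv assms(2) fB by (metis option.inject)+
    then show "indicator A i - indicator B i = - (indicator A j - indicator B j :: real)"
      by (simp add: indicator_def)
  qed
qed

lemma sum_indicator_UNIV: "(\<Sum>i\<in>UNIV. indicator A i) = real (card (A :: 'n::finite set))"
  by (simp add: indicator_def sum.If_cases)

text \<open>The line through \<open>u\<close> lies in the kernel, and both subspaces have dimension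
  one.\<close>

lemma kernel_eq_span:
  assumes "geometric_multiplicity A 0 = 1" "A *v u = 0" "u \<noteq> 0"
  shows "{x. A *v x = 0} = span {u}"
proof (rule sym, rule subspace_dim_equal)
  show "subspace {x. A *v x = 0}"
    by (auto simp: subspace_def matrix_vector_right_distrib matrix_vector_mult_scaleR)
  then show "span {u} \<subseteq> {x. A *v x = 0}"
    using assms(2) by (intro span_minimal) auto
  show "dim {x. A *v x = 0} \<le> dim (span {u})"
    using assms(1,3) by (simp add: geometric_multiplicity_def)
qed simp

text \<open>A trivial kernel on \<open>V\<close> makes the map injective there, so the image is a
  subspace of \<open>V\<close> of the same finite dimension.\<close>

lemma invariant_under_image_eq:
  fixes A :: "real ^ 'n::finite ^ 'n"
  assumes "invariant_under A V" "subspace V" "\<And>x. x \<in> V \<Longrightarrow> A *v x = 0 \<Longrightarrow> x = 0"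
  shows "(*v) A ` V = V"
proof (rule subspace_dim_equal)
  have lin: "linear ((*v) A)" by simp
  have "inj_on ((*v) A) (span V)"
    using linear_inj_on_iff_eq_0[OF lin assms(2)] assms(2,3) by (simp add: span_eq_iff[THEN iffD2])
  then show "dim V \<le> dim ((*v) A ` V)"
    using dim_image_eq[OF lin] by simp
  show "subspace ((*v) A ` V)"
    using linear_subspace_image[OF lin assms(2)] .
qed (use assms in \<open>auto simp: invariant_under_def\<close>)

theorem theorem6p8:
  fixes G :: "'n::finite pair_pre_digraph"
    and w :: "('n \<times> 'n) weight_fun"
    and P :: "'n set set"
    and f :: "'n set \<rightharpoonup> 'n set"
  assumes "weighted_digraph G w"
    and "weight_balanced G w"
    and "geometric_multiplicity (laplacian_matrix G w) 0 = 1"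
    and "tagged_partition (UNIV :: 'n set) P f"
    and "anti_synchrony f"
    and "invariant_under (laplacian_matrix G w) (polydiagonal P f)"
  shows "evenly_tagged P f"
proof -
  let ?L = "laplacian_matrix G w" and ?V = "polydiagonal P f"
  have "x = 0" if "x \<in> ?V" "?L *v x = 0" for x
  proof -
    have "x \<in> span {1}"
      using kernel_eq_span[OF assms(3) laplacian_matrix_mult_one] that(2)
      by (simp add: set_eq_iff)
    then obtain c where "x = c *\<^sub>R 1"
      by (auto simp: span_singleton)
    then show ?thesis
      using constant_in_polydiagonal_eq_0[OF assms(4,5)] that(1) by simp
  qed
  then have "(*v) ?L ` ?V = ?V"
    by (intro invariant_under_image_eq assms(6) subspace_polydiagonal)
  \<comment> \<open>Each \<open>x\<close> in \<open>?V\<close> is now \<open>?L *v y\<close> for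
    some \<open>y\<close>, and such vectors have coordinate sum zero by weight balance.\<close>
  then have sum_0: "(\<Sum>i\<in>UNIV. x $ i) = 0" if "x \<in> ?V" for x
    using that sum_laplacian_matrix_mult[OF assms(2)] by (metis imageE)
  note part_P = tagged_partitionD(1)[OF assms(4)] and dom = tagged_partitionD(2)[OF assms(4)]
  \<comment> \<open>The coordinate sum of the indicator vector of \<open>A\<close> is
    \<open>card A\<close>, which is positive since classes are nonempty.\<close>
  have tagged: "f A \<noteq> None" if "A \<in> P" for A
  proof
    assume "f A = None"
    then have "card A = 0"
      using sum_0[OF indicator_in_polydiagonal[OF assms(4) that]]
      by (simp add: sum_indicator_UNIV)
    then show False
      using that partition_onD3[OF part_P] by simp
  qed
  moreover have "card A = card B" if "f A = Some B" for A B
    using sum_0[OF indicator_diff_in_polydiagonal[OF assms(4) that]]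
    by (simp add: sum_subtractf sum_indicator_UNIV)
  ultimately show ?thesis
    using dom by (force simp: evenly_tagged_def fully_tagged_def)
qed

end
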